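(* Let $q \in \mathbb{N}$ and let $f : \mathbb{R}^n \to \mathbb{R}$ have a max-representation of order $q$ with finite index set $S$. If $f$ grows with order $p = 1$ around $x^* \in \mathbb{R}^n$, i.e., there are an open neighborhood $V \subseteq \mathbb{R}^n$ of $x^*$ and a constant $\beta > 0$ with $f(x) \geq f(x^* ) + \beta \| x - x^* \|$ for all $x \in V$, then property (P) holds for $p = 1$ and $x^*$: there are an open neighborhood $U \subseteq \mathbb{R}^n$ of $x^*$ and a constant $C > 0$ such that $\Lambda^1(x,\Delta) \geq C$ for all $x \in U$ and all $\Delta > 0$ with $x^* \notin \bar{B}_\Delta(x)$.
   Context: Notation: $\mathbb{N} = \{1,2,\dots\}$, $\|\cdot\|$ is the Euclidean norm, $\bar{B}_\Delta(x) = \{ y \in \mathbb{R}^n : \| y - x \| \leq \Delta \}$. Max-representation of order $q$ with finite index set $S$: $S$ is a (nonempty) finite set and $f_s : \mathbb{R}^n \to \mathbb{R}$, $s \in S$, are $(q+1)$-times continuously differentiable functions with $f(x) = \max_{s \in S} f_s(x)$ for all $x \in \mathbb{R}^n$. For $x \in \mathbb{R}^n$, $\Delta > 0$, $p \in \mathbb{N}$: $\Lambda^p(x,\Delta) = \dfrac{f(x) - f(z^*(x,\Delta))}{\Delta^p}$, where $z^*(x,\Delta) \in \arg\min_{z \in \bar{B}_\Delta(x)} f(z)$. *)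

theory Defs
  imports "HOL-Analysis.Analysis"
begin

(* k-times continuous (Frechet) differentiability on the whole space. The derivative
   x |-> Df(x) is tracked through its evaluations x |-> Df(x) v at each fixed direction v;
   in finite dimension these carry the same regularity as Df itself. *)
fun cont_differentiable :: "nat \<Rightarrow> ('a::euclidean_space \<Rightarrow> real) \<Rightarrow> bool" where
  "cont_differentiable 0 f \<longleftrightarrow> continuous_on UNIV f"
| "cont_differentiable (Suc k) f \<longleftrightarrow>
     (\<forall>x. f differentiable (at x)) \<and>
     (\<forall>v. cont_differentiable k (\<lambda>x. frechet_derivative f (at x) v))"

definition max_representation ::
  "nat \<Rightarrow> 's set \<Rightarrow> ('s \<Rightarrow> real ^ 'n \<Rightarrow> real) \<Rightarrow> (real ^ 'n \<Rightarrow> real) \<Rightarrow> bool" where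
  "max_representation q S fs f \<longleftrightarrow>
     finite S \<and> S \<noteq> {} \<and>
     (\<forall>s\<in>S. cont_differentiable (q + 1) (fs s)) \<and>
     (\<forall>x. f x = (MAX s\<in>S. fs s x))"

(* A fixed choice of minimizer over the closed ball. One exists whenever f is continuous
   and r is nonnegative, and the value of f there does not depend on the choice. *)
definition z_star :: "(real ^ 'n \<Rightarrow> real) \<Rightarrow> real ^ 'n \<Rightarrow> real \<Rightarrow> real ^ 'n" where
  "z_star f x r = arg_min_on f (cball x r)"

definition Lam :: "(real ^ 'n \<Rightarrow> real) \<Rightarrow> nat \<Rightarrow> real ^ 'n \<Rightarrow> real \<Rightarrow> real" where
  "Lam f p x r = (f x - f (z_star f x r)) / r ^ p"

definition grows_with_order :: "(real ^ 'n \<Rightarrow> real) \<Rightarrow> nat \<Rightarrow> real ^ 'n \<Rightarrow> bool" where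
  "grows_with_order f p xs \<longleftrightarrow>
     (\<exists>V \<beta>. open V \<and> xs \<in> V \<and> \<beta> > 0 \<and>
        (\<forall>x\<in>V. f x \<ge> f xs + \<beta> * norm (x - xs) ^ p))"

definition property_P :: "(real ^ 'n \<Rightarrow> real) \<Rightarrow> nat \<Rightarrow> real ^ 'n \<Rightarrow> bool" where
  "property_P f p xs \<longleftrightarrow>
     (\<exists>U C. open U \<and> xs \<in> U \<and> C > 0 \<and>
        (\<forall>x\<in>U. \<forall>r>0. xs \<notin> cball x r \<longrightarrow> Lam f p x r \<ge> C))"

end

theory Submission imports Defs begin

text \<open>Write \<open>d = norm (x - xs)\<close>.  For a ball around \<open>x\<close> of radius \<open>r < d\<close>, the trial point
  \<open>z = x + t (xs - x)\<close> with \<open>t = r / d\<close> lies in the ball, and the minimum over the ball is at most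
  \<open>f z\<close>; so it suffices that \<open>f z \<le> f x - C r\<close>.

  If \<open>f\<close> were convex, then \<open>f z \<le> f x - t (f x - f xs)\<close>, and linear growth, that is
  \<open>f x - f xs \<ge> \<beta> d\<close>, would give \<open>f x - f z \<ge> t \<beta> d = \<beta> r\<close>.  A maximum of \<open>C\<^sup>1\<close> functions need
  not be convex, but towards the fixed point \<open>xs\<close> it is convex up to an error \<open>t \<epsilon> d\<close>
  (\<open>almost_convex_towards_point\<close> for a single function, \<open>Max_almost_convex\<close> for the maximum), with
  \<open>\<epsilon>\<close> arbitrarily small near \<open>xs\<close>.  The error carries the same factor \<open>t d = r\<close> as the decrease
  itself, hence for \<open>\<epsilon> = \<beta> / 2\<close> half of the decrease survives.\<close>

lemma cont_differentiable_imp_continuous: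
  assumes "cont_differentiable k f"
  shows "continuous_on UNIV f"
proof (cases k)
  case (Suc m)
  then have "f differentiable (at x)" for x
    using assms by simp
  then show ?thesis
    by (meson continuous_at_imp_continuous_on differentiable_imp_continuous_within)
qed (use assms in simp)

text \<open>A \<open>C\<^sup>1\<close> function is strictly differentiable: its increments near \<open>a\<close> are approximated by
  the derivative at \<open>a\<close> uniformly in both end points.  Continuity of the derivative is only given
  direction by direction; summing over a basis bounds the operator norm.\<close>

lemma cont_differentiable_imp_strictly_differentiable:
  fixes f :: "'a::euclidean_space \<Rightarrow> real"
  assumes f: "cont_differentiable (Suc k) f" and "e > 0"
  shows "\<exists>\<delta>>0. \<forall>y\<in>ball a \<delta>. \<forall>z\<in>ball a \<delta>.
    \<bar>f z - f y - frechet_derivative f (at a) (z - y)\<bar> \<le> e * norm (z - y)"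
proof -
  let ?D = "\<lambda>x. frechet_derivative f (at x)"
  define g where "g = (\<lambda>y. \<Sum>b\<in>Basis. norm (?D y b - ?D a b))"
  have der: "(f has_derivative ?D x) (at x)" for x
    using f by (simp add: frechet_derivative_works)
  have "continuous_on UNIV (\<lambda>x. ?D x v)" for v
    using f cont_differentiable_imp_continuous by auto
  then have "continuous_on UNIV g"
    unfolding g_def by (intro continuous_intros)
  moreover have "g a = 0"
    by (simp add: g_def)
  ultimately have "(g \<longlongrightarrow> 0) (nhds a)"
    by (metis continuous_on_eq_continuous_at isCont_def tendsto_at_iff_tendsto_nhds open_UNIV UNIV_I)
  then have "\<forall>\<^sub>F y in nhds a. g y < e"
    using \<open>e > 0\<close> by (simp add: order_tendstoD)
  then obtain \<delta> where "\<delta> > 0" and \<delta>: "\<And>y. y \<in> ball a \<delta> \<Longrightarrow> g y < e"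
    by (auto simp: eventually_nhds_metric dist_commute)
  have "norm (f z - f y - ?D a (z - y)) \<le> norm (z - y) * e"
    if "y \<in> ball a \<delta>" "z \<in> ball a \<delta>" for y z
  proof (rule differentiable_bound_linearization[where S = "ball a \<delta>"])
    fix t :: real assume t: "t \<in> {0..1}"
    have "y + t *\<^sub>R (z - y) = (1 - t) *\<^sub>R y + t *\<^sub>R z"
      by (simp add: algebra_simps)
    then show "y + t *\<^sub>R (z - y) \<in> ball a \<delta>"
      using convexD[OF convex_ball that, of "1 - t" t] t by simp
  next
    fix x assume "x \<in> ball a \<delta>"
    show "(f has_derivative ?D x) (at x within ball a \<delta>)"
      using der has_derivative_at_withinI by blast
    have "bounded_linear (\<lambda>v. ?D x v - ?D a v)"
      using der by (intro bounded_linear_sub) (auto dest: has_derivative_bounded_linear)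
    from onorm_componentwise[OF this] have "onorm (\<lambda>v. ?D x v - ?D a v) \<le> g x"
      by (simp add: g_def)
    then show "onorm (?D x - ?D a) \<le> e"
      using \<delta>[OF \<open>x \<in> ball a \<delta>\<close>] by (simp add: fun_diff_def)
  qed (use \<open>\<delta> > 0\<close> in simp)
  then show ?thesis
    using \<open>\<delta> > 0\<close> by (auto simp: mult.commute intro!: exI[of _ \<delta>])
qed

text \<open>Strict differentiability compares both increments, from \<open>x\<close> to the intermediate point and
  from \<open>x\<close> to \<open>a\<close>, with the same linear map.  Once the second is scaled by \<open>t\<close>, the derivative
  cancels and each of the two errors is at most \<open>t * (e / 2) * norm (x - a)\<close>.  The factor \<open>t\<close>
  makes the error proportional to the length \<open>t * norm (x - a)\<close> of the step.\<close>

lemma almost_convex_towards_point: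
  fixes f :: "'a::euclidean_space \<Rightarrow> real"
  assumes f: "cont_differentiable (Suc k) f" and "e > 0"
  shows "\<forall>\<^sub>F x in nhds a. \<forall>t\<in>{0..1}.
    f (x + t *\<^sub>R (a - x)) \<le> (1 - t) * f x + t * f a + t * e * norm (x - a)"
proof -
  let ?L = "frechet_derivative f (at a)"
  obtain \<delta> where "\<delta> > 0" and \<delta>: "\<And>y z. y \<in> ball a \<delta> \<Longrightarrow> z \<in> ball a \<delta> \<Longrightarrow>
      \<bar>f z - f y - ?L (z - y)\<bar> \<le> e / 2 * norm (z - y)"
    using cont_differentiable_imp_strictly_differentiable[OF f, of "e / 2" a] \<open>e > 0\<close> by auto
  have lin: "linear ?L"
    using f by (auto intro: linear_frechet_derivative)
  have "f (x + t *\<^sub>R (a - x)) \<le> (1 - t) * f x + t * f a + t * e * norm (x - a)"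
    if x: "x \<in> ball a \<delta>" and t: "t \<in> {0..1}" for x t
  proof -
    define z where "z = x + t *\<^sub>R (a - x)"
    have "z = (1 - t) *\<^sub>R x + t *\<^sub>R a"
      by (simp add: z_def algebra_simps)
    then have z: "z \<in> ball a \<delta>"
      using convexD[OF convex_ball x, of a "1 - t" t] t \<open>\<delta> > 0\<close> by simp
    have Lz: "?L (z - x) = t * ?L (a - x)"
      by (simp add: z_def linear_cmul[OF lin])
    have nz: "norm (z - x) = t * norm (x - a)"
      using t by (simp add: z_def norm_minus_commute)
    have "f z - f x - t * ?L (a - x) \<le> e / 2 * (t * norm (x - a))"
      using \<delta>[OF x z] unfolding Lz nz by (rule abs_le_D1)
    moreover have "a \<in> ball a \<delta>"
      using \<open>\<delta> > 0\<close> by simp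
    then have "?L (a - x) - (f a - f x) \<le> e / 2 * norm (x - a)"
      using abs_le_D2[OF \<delta>[OF x]] by (metis minus_diff_eq norm_minus_commute)
    then have "t * (?L (a - x) - (f a - f x)) \<le> t * (e / 2 * norm (x - a))"
      using t by (intro mult_left_mono) auto
    ultimately show ?thesis
      unfolding z_def[symmetric] by (simp add: algebra_simps)
  qed
  then show ?thesis
    using \<open>\<delta> > 0\<close> by (auto simp: eventually_nhds_metric dist_commute intro!: exI[of _ \<delta>])
qed

text \<open>At the intermediate point the maximum is attained by a single index, and for that index the
  values at both end points are at most the maxima there.\<close>

lemma Max_almost_convex:
  fixes fs :: "'s \<Rightarrow> 'a::euclidean_space \<Rightarrow> real"
  assumes S: "finite S" "S \<noteq> {}"
    and fs: "\<And>s. s \<in> S \<Longrightarrow> cont_differentiable (Suc k) (fs s)" and "e > 0"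
    and f: "\<And>x. f x = (MAX s\<in>S. fs s x)"
  shows "\<forall>\<^sub>F x in nhds a. \<forall>t\<in>{0..1}.
    f (x + t *\<^sub>R (a - x)) \<le> (1 - t) * f x + t * f a + t * e * norm (x - a)"
proof -
  have "\<forall>\<^sub>F x in nhds a. \<forall>s\<in>S. \<forall>t\<in>{0..1}.
      fs s (x + t *\<^sub>R (a - x)) \<le> (1 - t) * fs s x + t * fs s a + t * e * norm (x - a)"
    using S fs \<open>e > 0\<close> by (intro eventually_ball_finite ballI almost_convex_towards_point)
  then show ?thesis
  proof (rule eventually_mono, intro ballI)
    fix x and t :: real
    assume conv: "\<forall>s\<in>S. \<forall>t\<in>{0..1}.
        fs s (x + t *\<^sub>R (a - x)) \<le> (1 - t) * fs s x + t * fs s a + t * e * norm (x - a)"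
      and t: "t \<in> {0..1}"
    obtain s where s: "s \<in> S" "f (x + t *\<^sub>R (a - x)) = fs s (x + t *\<^sub>R (a - x))"
      using S unfolding f by (metis obtains_MAX)
    have "fs s y \<le> f y" for y
      using S s(1) by (simp add: f)
    then have "(1 - t) * fs s x + t * fs s a \<le> (1 - t) * f x + t * f a"
      using t by (intro add_mono mult_left_mono) auto
    moreover have "fs s (x + t *\<^sub>R (a - x)) \<le> (1 - t) * fs s x + t * fs s a + t * e * norm (x - a)"
      using conv s(1) t by blast
    ultimately show "f (x + t *\<^sub>R (a - x)) \<le> (1 - t) * f x + t * f a + t * e * norm (x - a)"
      unfolding s(2) by linarith
  qed
qed

lemma continuous_on_MAX:
  fixes fs :: "'s \<Rightarrow> 'a::topological_space \<Rightarrow> real"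
  assumes "finite S" "S \<noteq> {}" "\<And>s. s \<in> S \<Longrightarrow> continuous_on A (fs s)"
  shows "continuous_on A (\<lambda>x. MAX s\<in>S. fs s x)"
  using assms
proof (induction rule: finite_ne_induct)
  case (insert s S)
  then have "continuous_on A (\<lambda>x. max (fs s x) (MAX s\<in>S. fs s x))"
    by (intro continuous_on_max) auto
  with insert show ?case
    by simp
qed simp

lemma z_star_le:
  assumes "continuous_on (cball x r) f" "z \<in> cball x r"
  shows "f (z_star f x r) \<le> f z"
proof -
  have "cball x r \<noteq> {}"
    using assms(2) by blast
  from continuous_attains_inf[OF compact_cball this assms(1)]
  obtain y where "y \<in> cball x r" "\<forall>u\<in>cball x r. f y \<le> f u" ..
  then have "is_arg_min f (\<lambda>u. u \<in> cball x r) y"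
    by (auto simp: is_arg_min_linorder)
  then have "is_arg_min f (\<lambda>u. u \<in> cball x r) (z_star f x r)"
    unfolding z_star_def arg_min_on_def arg_min_def by (rule someI)
  then show ?thesis
    using assms(2) by (simp add: is_arg_min_linorder)
qed

theorem theorem4p1:
  fixes f :: "real ^ 'n \<Rightarrow> real"
    and fs :: "'s \<Rightarrow> real ^ 'n \<Rightarrow> real"
    and S :: "'s set"
    and q :: nat
    and xs :: "real ^ 'n"
  assumes "q \<ge> 1"
    and "max_representation q S fs f"
    and "grows_with_order f 1 xs"
  shows "property_P f 1 xs"
proof -
  have S: "finite S" "S \<noteq> {}"
    and fs: "\<And>s. s \<in> S \<Longrightarrow> cont_differentiable (Suc q) (fs s)"
    and f: "\<And>x. f x = (MAX s\<in>S. fs s x)"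
    using assms(2) by (auto simp: max_representation_def)
  have "continuous_on UNIV (\<lambda>x. MAX s\<in>S. fs s x)"
    using S fs by (intro continuous_on_MAX cont_differentiable_imp_continuous)
  then have cont: "continuous_on A f" for A
    using f by (metis (no_types, lifting) continuous_on_cong continuous_on_subset top_greatest)
  obtain V \<beta> where "open V" "xs \<in> V" "\<beta> > 0"
    and grow: "\<And>x. x \<in> V \<Longrightarrow> f x \<ge> f xs + \<beta> * norm (x - xs)"
    using assms(3) by (auto simp: grows_with_order_def)
  have "\<forall>\<^sub>F x in nhds xs. \<forall>t\<in>{0..1}.
      f (x + t *\<^sub>R (xs - x)) \<le> (1 - t) * f x + t * f xs + t * (\<beta> / 2) * norm (x - xs)"
    using \<open>\<beta> > 0\<close> by (intro Max_almost_convex[OF S fs _ f]) auto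
  then obtain W where "open W" "xs \<in> W" and conv: "\<And>x t. x \<in> W \<Longrightarrow> t \<in> {0..1} \<Longrightarrow>
      f (x + t *\<^sub>R (xs - x)) \<le> (1 - t) * f x + t * f xs + t * (\<beta> / 2) * norm (x - xs)"
    unfolding eventually_nhds by blast
  have "Lam f 1 x r \<ge> \<beta> / 2" if x: "x \<in> V \<inter> W" and "r > 0" "xs \<notin> cball x r" for x r
  proof -
    define d where "d = norm (x - xs)"
    define t where "t = r / d"
    define z where "z = x + t *\<^sub>R (xs - x)"
    have "r < d"
      using that by (simp add: d_def dist_norm)
    then have t: "t \<in> {0..1}" "t * d = r"
      using \<open>r > 0\<close> by (auto simp: t_def)
    have "norm (x - z) = t * d"
      using t(1) by (simp add: z_def d_def norm_minus_commute)
    then have "z \<in> cball x r"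
      using t by (simp add: dist_norm)
    then have "f (z_star f x r) \<le> f z"
      using z_star_le cont by blast
    also have "f z \<le> f x - t * (f x - f xs) + \<beta> / 2 * (t * d)"
      using conv[of x t] x t(1) by (simp add: z_def d_def algebra_simps)
    also have "\<dots> \<le> f x - t * (\<beta> * d) + \<beta> / 2 * (t * d)"
      using grow[of x] x t(1) by (intro add_right_mono diff_left_mono mult_left_mono) (auto simp: d_def)
    also have "\<dots> = f x - \<beta> / 2 * r"
      unfolding t(2)[symmetric] by (simp add: algebra_simps)
    finally show ?thesis
      using \<open>r > 0\<close> by (simp add: Lam_def field_simps)
  qed
  moreover have "open (V \<inter> W)" "xs \<in> V \<inter> W" "\<beta> / 2 > 0"
    using \<open>open V\<close> \<open>open W\<close> \<open>xs \<in> V\<close> \<open>xs \<in> W\<close> \<open>\<beta> > 0\<close> by auto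
  ultimately show ?thesis
    unfolding property_P_def by blast
qed

end
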